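(* Let $d\ge 1$, let $\prec$ be a monomial order in $\mathbb{N}_0^d$ and let $\mathbf{f}\in \mathbb{N}_0^d\setminus\{\mathbf{0}\}$. Then $\mathcal{G}_{\prec}(\mathbf{f})$ is a rooted tree whose root is the ordinary generalized numerical semigroup $S(\mathbf{f})$. Moreover, if $S\in \mathcal{A}(\mathbf{f})$, then the children of $S$ are exactly the semigroups $S\cup \{\mathbf{x}\}$ for $\mathbf{x} \in \operatorname{D}_{\prec}(S)$.
   Context: $\mathbb{N}_0$ is the set of nonnegative integers. A generalized numerical semigroup (GNS) is a submonoid $S$ of $(\mathbb{N}_0^d,+)$ (closed under addition, containing $\mathbf{0}$) whose complement $\operatorname{H}(S)=\mathbb{N}_0^d\setminus S$ (the set of gaps) is finite. Its genus is $\operatorname{g}(S)=|\operatorname{H}(S)|$. Put $S^*=S\setminus\{\mathbf{0}\}$. The set of pseudo-Frobenius elements is $\operatorname{PF}(S)=\{\mathbf{h}\in\operatorname{H}(S)\mid \mathbf{h}+\mathbf{s}\in S\text{ for all }\mathbf{s}\in S^*\}$, the type of $S$ is $\operatorname{t}(S)=|\operatorname{PF}(S)|$, and the set of special gaps is $\operatorname{SG}(S)=\{\mathbf{h}\in\operatorname{PF}(S)\mid 2\mathbf{h}\in S\}$. For $\mathbf{x}=(x^{(1)},\dots,x^{(d)})\in\mathbb{N}_0^d$, $|\mathbf{x}|_\times=x^{(1)}\cdots x^{(d)}$, and $\mathbf{x}+\mathbf{1}$ is the vector with components $x^{(i)}+1$. The symbol $\le$ denotes the componentwise partial order. The Frobenius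 element of $S$ is the unique maximal element of $\operatorname{H}(S)$ with respect to $\le$, when a unique maximal element exists. $S$ is almost symmetric if $2\operatorname{g}(S)+1-\operatorname{t}(S)=|\mathbf{h}+\mathbf{1}|_\times$ for some $\mathbf{h}\in\operatorname{H}(S)$. A monomial order on $\mathbb{N}_0^d$ is a (strict) total order $\prec$ such that $\mathbf{v}\prec\mathbf{w}$ implies $\mathbf{v}+\mathbf{u}\prec\mathbf{w}+\mathbf{u}$ for every $\mathbf{u}\in\mathbb{N}_0^d$, and $\mathbf{0}\prec\mathbf{v}$ for every $\mathbf{v}\neq\mathbf{0}$. The ordinary GNS is $S(\mathbf{f})=(\mathbb{N}_0^d\setminus\{\mathbf{x}\in\mathbb{N}_0^d\mid\mathbf{x}\le\mathbf{f}\})\cup\{\mathbf{0}\}$. $\mathcal{A}(\mathbf{f})$ is the set of all almost symmetric GNSs in $\mathbb{N}_0^d$ having Frobenius element $\mathbf{f}$. For $S\in\mathcal{A}(\mathbf{f})$ put $\operatorname{N}(S)=\{\mathbf{x}\in S\mid\mathbf{x}\le\mathbf{f}\}$; $\operatorname{D}(S)=\{\mathbf{x}\in\operatorname{SG}(S)\setminus\{\mathbf{f}\}\mid S\cup\{\mathbf{x}\}\text{ is almost symmetric}\}$ (it is known that $S\cup\{\mathbf{x}\}$ is a GNS for each $\mathbf{x}\in\operatorname{SG}(S)$); $\operatorname{D}_\prec(S)=\{\mathbf{x}\in\operatorname{D}(S)\mid\mathbf{x}\prec\mathbf{y}\text{ for all }\mathbf{y}\in(\operatorname{N}(S)\setminus\{\mathbf{0}\})\cup\{\mathbf{f}\}\}$;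 and, if $S$ is not ordinary (i.e. $S\neq S(\mathbf{f})$), $\operatorname{low}_\prec(S)=\min_\prec(\operatorname{N}(S)\setminus\{\mathbf{0}\})$. $\mathcal{G}_\prec(\mathbf{f})=(\mathcal{A}(\mathbf{f}),\mathcal{E}_\prec)$ is the graph with vertex set $\mathcal{A}(\mathbf{f})$ in which $(T,S)\in\mathcal{E}_\prec$ if and only if $T$ is not ordinary and $S=T\setminus\{\operatorname{low}_\prec(T)\}$ (with $T,S\in\mathcal{A}(\mathbf{f})$). If $(T,S)\in\mathcal{E}_\prec$, $T$ is called a child of $S$. A rooted tree with root $R$ means: for every vertex $S$ there is a unique directed path of edges $(S_1,S_2),(S_2,S_3),\dots,(S_{n-1},S_n)$ with $S_1=S$ and $S_n=R$. *)

theory Defs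
  imports "HOL-Analysis.Finite_Cartesian_Product" "Graph_Theory.Pair_Digraph"
begin

text \<open>
  Vectors of nonnegative integers are elements of \<open>nat ^ 'd\<close> for a finite index type \<open>'d\<close>, which
  is nonempty, so the dimension is at least 1. On this type \<open>\<le>\<close> is the componentwise order.
\<close>

definition gaps :: "(nat ^ 'd) set \<Rightarrow> (nat ^ 'd) set" where
  "gaps S = UNIV - S"

definition gns :: "(nat ^ 'd) set \<Rightarrow> bool" where
  "gns S \<longleftrightarrow> 0 \<in> S \<and> (\<forall>x\<in>S. \<forall>y\<in>S. x + y \<in> S) \<and> finite (gaps S)"

definition genus :: "(nat ^ 'd) set \<Rightarrow> nat" where
  "genus S = card (gaps S)"

definition pseudo_frobenius :: "(nat ^ 'd) set \<Rightarrow> (nat ^ 'd) set" where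
  "pseudo_frobenius S = {h \<in> gaps S. \<forall>s \<in> S - {0}. h + s \<in> S}"

definition gns_type :: "(nat ^ 'd) set \<Rightarrow> nat" where
  "gns_type S = card (pseudo_frobenius S)"

definition special_gaps :: "(nat ^ 'd) set \<Rightarrow> (nat ^ 'd) set" where
  "special_gaps S = {h \<in> pseudo_frobenius S. h + h \<in> S}"

definition prod_comps :: "nat ^ 'd \<Rightarrow> nat" where
  "prod_comps x = (\<Prod>i\<in>UNIV. x $ i)"

definition maximal_in :: "(nat ^ 'd) set \<Rightarrow> nat ^ 'd \<Rightarrow> bool" where
  "maximal_in A x \<longleftrightarrow> x \<in> A \<and> (\<forall>y\<in>A. x \<le> y \<longrightarrow> y = x)"

definition is_frobenius :: "(nat ^ 'd) set \<Rightarrow> nat ^ 'd \<Rightarrow> bool" where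
  "is_frobenius S f \<longleftrightarrow> maximal_in (gaps S) f \<and> (\<forall>g. maximal_in (gaps S) g \<longrightarrow> g = f)"

text \<open>The defining equation is stated over \<open>int\<close> to avoid truncated subtraction; \<open>1\<close> in
  \<open>h + 1\<close> is the all-ones vector.\<close>

definition almost_symmetric :: "(nat ^ 'd) set \<Rightarrow> bool" where
  "almost_symmetric S \<longleftrightarrow> gns S \<and>
     (\<exists>h \<in> gaps S. 2 * int (genus S) + 1 - int (gns_type S) = int (prod_comps (h + 1)))"

definition monomial_order :: "(nat ^ 'd \<Rightarrow> nat ^ 'd \<Rightarrow> bool) \<Rightarrow> bool" where
  "monomial_order prec \<longleftrightarrow>
     irreflp prec \<and> transp prec \<and> totalp prec \<and>
     (\<forall>v w u. prec v w \<longrightarrow> prec (v + u) (w + u)) \<and>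
     (\<forall>v. v \<noteq> 0 \<longrightarrow> prec 0 v)"

definition ordinary_gns :: "nat ^ 'd \<Rightarrow> (nat ^ 'd) set" where
  "ordinary_gns f = (UNIV - {x. x \<le> f}) \<union> {0}"

definition almost_symmetric_gns_set :: "nat ^ 'd \<Rightarrow> (nat ^ 'd) set set" where
  "almost_symmetric_gns_set f = {S. almost_symmetric S \<and> is_frobenius S f}"

text \<open>In the following notions \<open>f\<close> is the Frobenius element of \<open>S\<close>.\<close>

definition N_set :: "nat ^ 'd \<Rightarrow> (nat ^ 'd) set \<Rightarrow> (nat ^ 'd) set" where
  "N_set f S = {x \<in> S. x \<le> f}"

definition D_set :: "nat ^ 'd \<Rightarrow> (nat ^ 'd) set \<Rightarrow> (nat ^ 'd) set" where
  "D_set f S = {x \<in> special_gaps S - {f}. almost_symmetric (S \<union> {x})}"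

definition D_prec ::
  "(nat ^ 'd \<Rightarrow> nat ^ 'd \<Rightarrow> bool) \<Rightarrow> nat ^ 'd \<Rightarrow> (nat ^ 'd) set \<Rightarrow> (nat ^ 'd) set" where
  "D_prec prec f S = {x \<in> D_set f S. \<forall>y \<in> (N_set f S - {0}) \<union> {f}. prec x y}"

text \<open>Meaningful only if \<open>S\<close> is not ordinary, i.e. if \<open>N_set f S - {0}\<close> is nonempty.\<close>

definition low ::
  "(nat ^ 'd \<Rightarrow> nat ^ 'd \<Rightarrow> bool) \<Rightarrow> nat ^ 'd \<Rightarrow> (nat ^ 'd) set \<Rightarrow> nat ^ 'd" where
  "low prec f S =
     (THE x. x \<in> N_set f S - {0} \<and> (\<forall>y \<in> N_set f S - {0}. y \<noteq> x \<longrightarrow> prec x y))"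

definition gns_graph ::
  "(nat ^ 'd \<Rightarrow> nat ^ 'd \<Rightarrow> bool) \<Rightarrow> nat ^ 'd \<Rightarrow> (nat ^ 'd) set pair_pre_digraph" where
  "gns_graph prec f =
     \<lparr> pverts = almost_symmetric_gns_set f,
       parcs = {(T, S). T \<in> almost_symmetric_gns_set f \<and> S \<in> almost_symmetric_gns_set f \<and>
                        T \<noteq> ordinary_gns f \<and> S = T - {low prec f T}} \<rparr>"

definition children :: "'a pair_pre_digraph \<Rightarrow> 'a \<Rightarrow> 'a set" where
  "children G S = {T. (T, S) \<in> parcs G}"

text \<open>Arcs point towards the root; the empty walk is the path from the root to itself.\<close>

definition rooted_tree :: "'a pair_pre_digraph \<Rightarrow> 'a \<Rightarrow> bool" where
  "rooted_tree G R \<longleftrightarrow>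
     R \<in> pverts G \<and> (\<forall>S \<in> pverts G. \<exists>!p. pre_digraph.awalk (with_proj G) S p R)"

end

theory Submission
  imports Defs
begin

text \<open>
  The numerical condition in the definition of almost symmetry hides a condition on single gaps,
  and once that is uncovered everything else is a short computation with the reflection
  \<open>x \<mapsto> f - x\<close> of the box \<open>{x. x \<le> f}\<close>.

  If \<open>f\<close> is the Frobenius element of \<open>S\<close>, then all gaps lie in this box. The reflection maps
  \<open>S\<close> below \<open>f\<close> injectively to gaps, because \<open>x\<close> and \<open>f - x\<close> cannot both lie in \<open>S\<close> as their sum
  is \<open>f\<close>. Hence the number of gaps \<open>h\<close> with \<open>f - h \<notin> S\<close> is twice the genus minus the
  size of the box. All pseudo-Frobenius elements except \<open>f\<close> are gaps of this kind, so the type is at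
  most one more than their number, and \<open>S\<close> is almost symmetric if and only if the two sets agree.
  In other words (\<open>almost_symmetric_gns_set_iff\<close>): every gap \<open>h\<close> satisfies \<open>f - h \<in> S\<close> or is
  pseudo-Frobenius.

  This criterion survives the removal of the least nonzero element \<open>x\<close> of \<open>T\<close> below \<open>f\<close>
  (\<open>remove_low_almost_symmetric\<close>). A monomial order extends the componentwise order, so
  no element of \<open>T\<close> other than \<open>0\<close> and \<open>x\<close> lies below \<open>x\<close> componentwise. Therefore no sum of a
  gap or an element with a nonzero remaining element can hit \<open>x\<close>, and the only gap whose partner is
  lost, namely \<open>f - x\<close>, becomes pseudo-Frobenius: \<open>f - x + s \<le> f\<close> would force \<open>s \<le> x\<close>.

  So every vertex other than the ordinary semigroup has exactly one outgoing arc, along which the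
  number of elements below \<open>f\<close> drops. An acyclic functional graph with a single sink is a rooted tree
  (\<open>rooted_treeI\<close>). For the children, removing \<open>x = low T\<close> and adding \<open>x\<close> undo each other, and
  \<open>D_prec\<close> collects precisely the elements that become the least one after they are added
  (\<open>low_mem_D_prec\<close> and \<open>add_D_prec\<close>).
\<close>

section \<open>The componentwise order and monomial orders\<close>

lemma vec_diff_add_cancel:
  fixes x f :: "nat ^ 'd::finite"
  assumes "x \<le> f"
  shows "(f - x) + x = f"
  using assms by (simp add: vec_eq_iff less_eq_vec_def)

lemma vec_diff_diff_cancel:
  fixes x f :: "nat ^ 'd::finite"
  assumes "x \<le> f"
  shows "f - (f - x) = x"
  using assms by (simp add: vec_eq_iff less_eq_vec_def)

lemma vec_diff_le:
  fixes x f :: "nat ^ 'd::finite"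
  shows "f - x \<le> f"
  by (simp add: less_eq_vec_def)

lemma vec_le_add:
  fixes x y :: "nat ^ 'd::finite"
  shows "x \<le> x + y" "x \<le> y + x"
  by (simp_all add: less_eq_vec_def)

lemma bij_betw_box:
  fixes f :: "nat ^ 'd::finite"
  shows "bij_betw vec_nth {x. x \<le> f} (PiE UNIV (\<lambda>i. {..f $ i}))"
  by (rule bij_betwI[where g = vec_lambda]) (auto simp: less_eq_vec_def)

lemma finite_box:
  fixes f :: "nat ^ 'd::finite"
  shows "finite {x. x \<le> f}"
  using bij_betw_finite[OF bij_betw_box[of f]] by (simp add: finite_PiE)

lemma card_box:
  fixes f :: "nat ^ 'd::finite"
  shows "card {x. x \<le> f} = prod_comps (f + 1)"
  using bij_betw_same_card[OF bij_betw_box[of f]]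
  by (simp add: card_PiE prod_comps_def one_vec_def)

lemma prod_comps_mono:
  fixes x y :: "nat ^ 'd::finite"
  assumes "x \<le> y"
  shows "prod_comps x \<le> prod_comps y"
  unfolding prod_comps_def using assms by (intro prod_mono) (simp add: less_eq_vec_def)

text \<open>
  Translating \<open>0 \<prec> y - x\<close> by \<open>x\<close> compares \<open>x\<close> with \<open>y\<close>.
\<close>
lemma monomial_order_extends_le:
  fixes x y :: "nat ^ 'd::finite"
  assumes prec: "monomial_order prec" and "x \<le> y" "x \<noteq> y"
  shows "prec x y"
proof -
  have eq: "(y - x) + x = y" using assms vec_diff_add_cancel by blast
  then have "y - x \<noteq> 0" using \<open>x \<noteq> y\<close> by auto
  then have "prec (0 + x) ((y - x) + x)" using prec unfolding monomial_order_def by blast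
  then show ?thesis by (simp add: eq)
qed

lemma monomial_order_asym:
  assumes "monomial_order prec" and "prec x y"
  shows "\<not> prec y x"
  using assms unfolding monomial_order_def by (meson irreflpD transpD)

lemma monomial_order_finite_has_least:
  assumes prec: "monomial_order prec" and "finite A" "A \<noteq> {}"
  shows "\<exists>x\<in>A. \<forall>y\<in>A. y \<noteq> x \<longrightarrow> prec x y"
  using assms(2,3)
proof (induction rule: finite_ne_induct)
  case (singleton x)
  then show ?case by simp
next
  case (insert a F)
  then obtain x where x: "x \<in> F" "\<forall>y\<in>F. y \<noteq> x \<longrightarrow> prec x y" by blast
  have "prec a x \<or> prec x a" using prec x(1) insert.hyps unfolding monomial_order_def
    by (metis totalpD)
  moreover have "transp prec" using prec unfolding monomial_order_def by blast
  ultimately show ?case using x by (metis insert_iff transpD)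
qed

section \<open>Almost symmetry as a condition on the gaps\<close>

text \<open>
  A finite poset with a unique maximal element has that element as its greatest one: each gap lies
  below some maximal gap.
\<close>
lemma is_frobenius_iff:
  fixes S :: "(nat ^ 'd::finite) set"
  assumes "finite (gaps S)"
  shows "is_frobenius S f \<longleftrightarrow> f \<in> gaps S \<and> (\<forall>h\<in>gaps S. h \<le> f)"
proof
  assume fr: "is_frobenius S f"
  have "h \<le> f" if h: "h \<in> gaps S" for h
  proof -
    obtain m where "m \<in> gaps S" "h \<le> m" "\<forall>b\<in>gaps S. m \<le> b \<longrightarrow> m = b"
      using finite_has_maximal2[OF assms h] by blast
    then have "maximal_in (gaps S) m" by (auto simp: maximal_in_def)
    then show ?thesis using fr \<open>h \<le> m\<close> unfolding is_frobenius_def by blast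
  qed
  then show "f \<in> gaps S \<and> (\<forall>h\<in>gaps S. h \<le> f)"
    using fr by (auto simp: is_frobenius_def maximal_in_def)
next
  assume "f \<in> gaps S \<and> (\<forall>h\<in>gaps S. h \<le> f)"
  then show "is_frobenius S f"
    unfolding is_frobenius_def maximal_in_def by (metis order_antisym)
qed

text \<open>
  The gaps below \<open>f\<close> that the reflection \<open>h \<mapsto> f - h\<close> does not send into \<open>S\<close>. The vector
  subtraction truncates in each component, so the set is only meaningful if all gaps are below \<open>f\<close>.
\<close>
definition unpaired_gaps :: "nat ^ 'd \<Rightarrow> (nat ^ 'd) set \<Rightarrow> (nat ^ 'd) set" where
  "unpaired_gaps f S = {h \<in> gaps S. f - h \<notin> S}"

text \<open>
  If \<open>f - h\<close> were a nonzero element of \<open>S\<close>, adding it to a pseudo-Frobenius \<open>h\<close> would put \<open>f\<close>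
  into \<open>S\<close>.
\<close>
lemma pseudo_frobenius_subset:
  fixes S :: "(nat ^ 'd::finite) set"
  assumes "f \<in> gaps S" "\<forall>h\<in>gaps S. h \<le> f"
  shows "pseudo_frobenius S - {f} \<subseteq> unpaired_gaps f S"
proof
  fix h assume h: "h \<in> pseudo_frobenius S - {f}"
  then have hg: "h \<in> gaps S" by (auto simp: pseudo_frobenius_def)
  then have eq: "(f - h) + h = f" using assms vec_diff_add_cancel by blast
  have "f - h \<notin> S"
  proof
    assume "f - h \<in> S"
    moreover have "f - h \<noteq> 0" using eq h by auto
    ultimately have "h + (f - h) \<in> S" using h by (auto simp: pseudo_frobenius_def)
    then show False using eq assms(1) by (simp add: add.commute gaps_def)
  qed
  then show "h \<in> unpaired_gaps f S" using hg by (simp add: unpaired_gaps_def)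
qed

text \<open>
  The box below \<open>f\<close> splits into the elements of \<open>S\<close> and the gaps, and reflection is a bijection
  from the former onto the gaps that are not unpaired.
\<close>
lemma card_unpaired_gaps:
  fixes S :: "(nat ^ 'd::finite) set"
  assumes S: "gns S" and f: "f \<in> gaps S" "\<forall>h\<in>gaps S. h \<le> f"
  shows "int (card (unpaired_gaps f S)) = 2 * int (genus S) - int (prod_comps (f + 1))"
proof -
  let ?N = "{x \<in> S. x \<le> f}" and ?L = "unpaired_gaps f S"
  have fin: "finite (gaps S)" using S by (simp add: gns_def)
  have finN: "finite ?N" by (rule finite_subset[OF _ finite_box[of f]]) auto
  have "bij_betw (\<lambda>x. f - x) ?N (gaps S - ?L)"
  proof (rule bij_betwI[where g = "\<lambda>x. f - x"])
    show "(\<lambda>x. f - x) \<in> ?N \<rightarrow> gaps S - ?L"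
    proof
      fix x assume x: "x \<in> ?N"
      then have eq: "(f - x) + x = f" "f - (f - x) = x"
        using vec_diff_add_cancel vec_diff_diff_cancel by blast+
      have "f - x \<notin> S" using S x f(1) eq(1) unfolding gns_def gaps_def by force
      then show "f - x \<in> gaps S - ?L" using x eq(2) by (simp add: gaps_def unpaired_gaps_def)
    qed
    show "(\<lambda>x. f - x) \<in> gaps S - ?L \<rightarrow> ?N"
      by (auto simp: unpaired_gaps_def vec_diff_le)
  qed (use f vec_diff_diff_cancel in auto)
  then have "card ?N = card (gaps S - ?L)" by (rule bij_betw_same_card)
  moreover have "card (gaps S) = card ?L + card (gaps S - ?L)"
  proof -
    have "?L \<subseteq> gaps S" by (auto simp: unpaired_gaps_def)
    then show ?thesis using fin card_mono[of "gaps S" ?L] finite_subset[of ?L]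
      by (simp add: card_Diff_subset)
  qed
  moreover have "card {x. x \<le> f} = card ?N + card (gaps S)"
  proof -
    have "{x. x \<le> f} = ?N \<union> gaps S" "?N \<inter> gaps S = {}" using f by (auto simp: gaps_def)
    then show ?thesis using card_Un_disjoint[OF finN fin] by simp
  qed
  ultimately show ?thesis unfolding genus_def card_box by simp
qed

text \<open>
  The definition of almost symmetry allows any gap \<open>h\<close> as a witness, but only \<open>f\<close> can serve: the
  left-hand side of the defining equation is always at least the value at \<open>f\<close>, since the type
  is at most one more than the number of unpaired gaps, while the right-hand side is monotone in
  \<open>h \<le> f\<close>. Equality then says that the inclusion \<open>pseudo_frobenius_subset\<close> is an equality.
\<close>
lemma almost_symmetric_gns_set_iff:
  fixes S :: "(nat ^ 'd::finite) set"
  shows "S \<in> almost_symmetric_gns_set f \<longleftrightarrow>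
    gns S \<and> f \<in> gaps S \<and> (\<forall>h\<in>gaps S. h \<le> f) \<and>
    (\<forall>h\<in>gaps S. f - h \<in> S \<or> h \<in> pseudo_frobenius S)"
proof (cases "gns S \<and> f \<in> gaps S \<and> (\<forall>h\<in>gaps S. h \<le> f)")
  case True
  then have S: "gns S" and f: "f \<in> gaps S" "\<forall>h\<in>gaps S. h \<le> f" by auto
  let ?L = "unpaired_gaps f S" and ?P = "pseudo_frobenius S - {f}"
  have fin: "finite (gaps S)" using S by (simp add: gns_def)
  have finL: "finite ?L" using fin by (simp add: unpaired_gaps_def)
  have fP: "f \<in> pseudo_frobenius S"
  proof -
    have "f + s \<in> S" if "s \<noteq> 0" for s
    proof (rule ccontr)
      assume "f + s \<notin> S"
      then have "f + s \<le> f" using f(2) by (simp add: gaps_def)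
      then have "f + s = f" using vec_le_add(1)[of f s] by (rule order_antisym)
      then show False using that by simp
    qed
    then show ?thesis using f(1) by (auto simp: pseudo_frobenius_def)
  qed
  have "finite (pseudo_frobenius S)" using fin by (simp add: pseudo_frobenius_def)
  then have t: "gns_type S = card ?P + 1"
    using fP card_Suc_Diff1[of "pseudo_frobenius S" f] by (simp add: gns_type_def)
  note cardL = card_unpaired_gaps[OF S f]
  note sub = pseudo_frobenius_subset[OF f]
  have le: "prod_comps (h + 1) \<le> prod_comps (f + 1)" if "h \<in> gaps S" for h
    using f(2) that by (intro prod_comps_mono) (auto simp: less_eq_vec_def)
  have cardP: "card ?P \<le> card ?L" using sub finL by (rule card_mono[rotated])
  have eq1: "2 * int (genus S) + 1 - int (gns_type S)
      = int (prod_comps (f + 1)) + (int (card ?L) - int (card ?P))"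
    using cardL t by simp
  have "almost_symmetric S \<longleftrightarrow> card ?P = card ?L"
  proof
    assume "almost_symmetric S"
    then obtain h where "h \<in> gaps S"
      "2 * int (genus S) + 1 - int (gns_type S) = int (prod_comps (h + 1))"
      unfolding almost_symmetric_def by blast
    then show "card ?P = card ?L" using eq1 le[of h] cardP by linarith
  next
    assume "card ?P = card ?L"
    then have "2 * int (genus S) + 1 - int (gns_type S) = int (prod_comps (f + 1))"
      using eq1 by linarith
    then show "almost_symmetric S" unfolding almost_symmetric_def using S f(1) by blast
  qed
  also have "\<dots> \<longleftrightarrow> ?P = ?L"
    using card_subset_eq[OF finL sub] by metis
  also have "\<dots> \<longleftrightarrow> (\<forall>h\<in>gaps S. f - h \<in> S \<or> h \<in> pseudo_frobenius S)"
  proof -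
    have "0 \<in> S" using S by (simp add: gns_def)
    then have "f \<notin> ?L" by (simp add: unpaired_gaps_def)
    then have "?P = ?L \<longleftrightarrow> ?L \<subseteq> pseudo_frobenius S" using sub by blast
    also have "\<dots> \<longleftrightarrow> (\<forall>h\<in>gaps S. f - h \<in> S \<or> h \<in> pseudo_frobenius S)"
      unfolding unpaired_gaps_def by blast
    finally show ?thesis .
  qed
  finally show ?thesis
    using S f by (simp add: almost_symmetric_gns_set_def is_frobenius_iff[OF fin])
next
  case False
  moreover have "gns S \<and> f \<in> gaps S \<and> (\<forall>h\<in>gaps S. h \<le> f)"
    if "S \<in> almost_symmetric_gns_set f"
  proof -
    have "gns S" "is_frobenius S f"
      using that by (simp_all add: almost_symmetric_gns_set_def almost_symmetric_def)
    moreover from \<open>gns S\<close> have "finite (gaps S)" by (simp add: gns_def)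
    ultimately show ?thesis using is_frobenius_iff by blast
  qed
  ultimately show ?thesis by argo
qed

section \<open>The ordinary semigroup and the removal of the least element\<close>

text \<open>
  Every nonzero element of the ordinary semigroup lies outside the box below \<open>f\<close>, and so does
  whatever lies above it; hence all gaps are pseudo-Frobenius.
\<close>
lemma ordinary_gns_almost_symmetric:
  fixes f :: "nat ^ 'd::finite"
  assumes "f \<noteq> 0"
  shows "ordinary_gns f \<in> almost_symmetric_gns_set f"
proof -
  let ?S = "ordinary_gns f"
  have gaps: "gaps ?S = {x. x \<le> f} - {0}" by (auto simp: gaps_def ordinary_gns_def)
  have sum: "x + y \<in> ?S" if "y \<in> ?S" "y \<noteq> 0" for x y
    using that vec_le_add(2)[of y x] by (auto simp: ordinary_gns_def dest: order_trans)
  have "gns ?S"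
    unfolding gns_def gaps
  proof (intro conjI ballI)
    show "0 \<in> ?S" by (simp add: ordinary_gns_def)
    show "x + y \<in> ?S" if "x \<in> ?S" "y \<in> ?S" for x y
      using that sum[of y x] by (cases "y = 0") auto
    show "finite ({x. x \<le> f} - {0})" by (simp add: finite_box)
  qed
  moreover have "h \<in> pseudo_frobenius ?S" if "h \<in> gaps ?S" for h
    using that sum by (auto simp: pseudo_frobenius_def)
  ultimately show ?thesis
    using assms by (auto simp: almost_symmetric_gns_set_iff gaps)
qed

lemma ordinary_iff_N_set:
  fixes S :: "(nat ^ 'd::finite) set"
  assumes "S \<in> almost_symmetric_gns_set f"
  shows "S = ordinary_gns f \<longleftrightarrow> N_set f S - {0} = {}"
proof -
  have "0 \<in> S" "\<forall>h. h \<notin> S \<longrightarrow> h \<le> f"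
    using assms by (auto simp: almost_symmetric_gns_set_iff gns_def gaps_def)
  then show ?thesis by (auto simp: ordinary_gns_def N_set_def)
qed

lemma low_eqI:
  assumes prec: "monomial_order prec"
    and "x \<in> N_set f T - {0}" "\<forall>y \<in> N_set f T - {0}. y \<noteq> x \<longrightarrow> prec x y"
  shows "low prec f T = x"
  unfolding low_def
proof (rule the_equality)
  show "x \<in> N_set f T - {0} \<and> (\<forall>y \<in> N_set f T - {0}. y \<noteq> x \<longrightarrow> prec x y)"
    using assms by blast
next
  fix z assume z: "z \<in> N_set f T - {0} \<and> (\<forall>y \<in> N_set f T - {0}. y \<noteq> z \<longrightarrow> prec z y)"
  show "z = x"
  proof (rule ccontr)
    assume "z \<noteq> x"
    then have "prec x z" "prec z x" using assms(2,3) z by (metis, metis)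
    then show False using monomial_order_asym[OF prec] by blast
  qed
qed

lemma low_least:
  fixes T :: "(nat ^ 'd::finite) set"
  assumes prec: "monomial_order prec" and T: "T \<in> almost_symmetric_gns_set f"
    and "T \<noteq> ordinary_gns f"
  shows "low prec f T \<in> N_set f T - {0}"
    and "\<And>y. y \<in> N_set f T - {0} \<Longrightarrow> y \<noteq> low prec f T \<Longrightarrow> prec (low prec f T) y"
proof -
  have "finite (N_set f T)" by (rule finite_subset[OF _ finite_box[of f]]) (auto simp: N_set_def)
  then obtain x where x: "x \<in> N_set f T - {0}" "\<forall>y \<in> N_set f T - {0}. y \<noteq> x \<longrightarrow> prec x y"
    using monomial_order_finite_has_least[OF prec, of "N_set f T - {0}"]
      ordinary_iff_N_set[OF T] assms(3) by blast
  have low: "low prec f T = x" by (rule low_eqI[OF prec x])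
  show "low prec f T \<in> N_set f T - {0}" unfolding low by (fact x(1))
  show "prec (low prec f T) y" if "y \<in> N_set f T - {0}" "y \<noteq> low prec f T" for y
    using x(2) that unfolding low by blast
qed

text \<open>
  Minimality for the monomial order implies minimality for the componentwise order. It is this
  form that controls which sums can be equal to the removed element.
\<close>
lemma no_smaller_element_below_low:
  fixes T :: "(nat ^ 'd::finite) set"
  assumes prec: "monomial_order prec" and T: "T \<in> almost_symmetric_gns_set f"
    and "T \<noteq> ordinary_gns f" and s: "s \<in> T" "s \<le> low prec f T"
  shows "s = 0 \<or> s = low prec f T"
proof (rule ccontr)
  assume neg: "\<not> ?thesis"
  have "low prec f T \<le> f" using low_least(1)[OF assms(1-3)] by (simp add: N_set_def)
  then have "s \<in> N_set f T - {0}" using s neg by (auto simp: N_set_def)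
  then have "prec (low prec f T) s" using low_least(2)[OF assms(1-3)] neg by blast
  moreover have "prec s (low prec f T)" using monomial_order_extends_le[OF prec s(2)] neg by blast
  ultimately show False using monomial_order_asym[OF prec] by blast
qed

lemma low_special_gap:
  fixes T :: "(nat ^ 'd::finite) set"
  assumes prec: "monomial_order prec" and T: "T \<in> almost_symmetric_gns_set f"
    and "T \<noteq> ordinary_gns f"
  shows "low prec f T \<in> special_gaps (T - {low prec f T})"
proof -
  have "low prec f T \<in> T" "low prec f T \<noteq> 0" using low_least(1)[OF assms] by (auto simp: N_set_def)
  moreover have "\<forall>x\<in>T. \<forall>y\<in>T. x + y \<in> T"
    using T by (auto simp: almost_symmetric_gns_set_iff gns_def)
  ultimately show ?thesis by (auto simp: special_gaps_def pseudo_frobenius_def gaps_def)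
qed

text \<open>
  Each gap of the smaller set has to be checked against the criterion. The new gap \<open>x\<close> is
  pseudo-Frobenius because \<open>T\<close> is closed under addition. An old gap with reflection in \<open>T\<close> keeps it
  unless the reflection is \<open>x\<close>, and then \<open>f - x + s\<close> leaves the box. An old pseudo-Frobenius gap
  stays one since \<open>h + s = x\<close> would make \<open>s\<close> a smaller element than \<open>x\<close>.
\<close>
lemma remove_low_almost_symmetric:
  fixes T :: "(nat ^ 'd::finite) set"
  assumes prec: "monomial_order prec" and T: "T \<in> almost_symmetric_gns_set f"
    and "T \<noteq> ordinary_gns f"
  shows "T - {low prec f T} \<in> almost_symmetric_gns_set f"
proof -
  let ?x = "low prec f T"
  let ?S = "T - {?x}"
  have x: "?x \<in> T" "?x \<noteq> 0" "?x \<le> f" using low_least(1)[OF assms] by (auto simp: N_set_def)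
  have below: "s = 0" if "s \<in> ?S" "s \<le> ?x" for s
    using no_smaller_element_below_low[OF assms] that by blast
  have zero: "0 \<in> T" and add: "\<And>a b. a \<in> T \<Longrightarrow> b \<in> T \<Longrightarrow> a + b \<in> T"
    and fin: "finite (gaps T)" and f: "f \<in> gaps T" and le: "\<And>h. h \<in> gaps T \<Longrightarrow> h \<le> f"
    and dich: "\<And>h. h \<in> gaps T \<Longrightarrow> f - h \<in> T \<or> h \<in> pseudo_frobenius T"
    using T by (auto simp: almost_symmetric_gns_set_iff gns_def)
  have gaps: "gaps ?S = insert ?x (gaps T)" using x by (auto simp: gaps_def)
  have "gns ?S"
    unfolding gns_def
  proof (intro conjI ballI)
    show "0 \<in> ?S" using zero x by simp
    show "finite (gaps ?S)" using fin by (simp add: gaps)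
    show "a + b \<in> ?S" if ab: "a \<in> ?S" "b \<in> ?S" for a b
    proof -
      have "a + b \<noteq> ?x"
      proof
        assume eq: "a + b = ?x"
        then have "a = 0" using below[OF ab(1)] vec_le_add(1)[of a b] by simp
        moreover have "b = 0" using eq below[OF ab(2)] vec_le_add(2)[of b a] by simp
        ultimately show False using eq x(2) by simp
      qed
      then show ?thesis using add ab by simp
    qed
  qed
  moreover have "f - h \<in> ?S \<or> h \<in> pseudo_frobenius ?S" if h: "h \<in> gaps ?S" for h
  proof -
    consider "h = ?x" | "h \<in> gaps T" "f - h \<in> T" "f - h \<noteq> ?x"
      | "h \<in> gaps T" "f - h = ?x" | "h \<in> gaps T" "h \<in> pseudo_frobenius T"
      using h dich gaps by blast
    then show ?thesis
    proof cases
      case 1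
      then show ?thesis using low_special_gap[OF assms] by (simp add: special_gaps_def)
    next
      case 2
      then show ?thesis by simp
    next
      case 3
      have hx: "h + ?x = f"
        using 3 vec_diff_add_cancel[OF le[OF 3(1)]] by (simp add: add.commute)
      have "h + s \<in> ?S" if s: "s \<in> ?S - {0}" for s
      proof -
        have "\<not> h + s \<le> f"
        proof
          assume "h + s \<le> f"
          then have "h + s \<le> h + ?x" by (simp only: hx)
          then have "s \<le> ?x" by (simp add: less_eq_vec_def)
          then show False using below s by blast
        qed
        then have "h + s \<notin> gaps ?S" using gaps le x(3) by auto
        then show ?thesis by (simp add: gaps_def)
      qed
      then show ?thesis using h by (simp add: pseudo_frobenius_def)
    next
      case 4
      have "h + s \<in> ?S" if s: "s \<in> ?S - {0}" for s
      proof -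
        have "h + s \<in> T" using 4 s by (auto simp: pseudo_frobenius_def)
        moreover have "h + s \<noteq> ?x" using below[of s] s vec_le_add(2)[of s h] by auto
        ultimately show ?thesis by simp
      qed
      then show ?thesis using h by (simp add: pseudo_frobenius_def)
    qed
  qed
  ultimately show ?thesis
    using f le x(3) by (auto simp: almost_symmetric_gns_set_iff gaps)
qed

section \<open>The tree of almost symmetric semigroups\<close>

lemma gns_graph_arc_iff:
  fixes S T :: "(nat ^ 'd::finite) set"
  assumes "monomial_order prec"
  shows "(T, S) \<in> parcs (gns_graph prec f) \<longleftrightarrow>
    T \<in> almost_symmetric_gns_set f \<and> T \<noteq> ordinary_gns f \<and> S = T - {low prec f T}"
  using remove_low_almost_symmetric[OF assms] by (auto simp: gns_graph_def)

text \<open>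
  The measure \<open>\<mu>\<close> drops along the arc out of each vertex other than \<open>R\<close>, so following arcs ends
  at \<open>R\<close>. The walk is forced at every step, and it cannot pass through \<open>R\<close> before its end because
  \<open>R\<close> has no outgoing arc; this gives uniqueness among all walks, including those that might repeat
  vertices.
\<close>
lemma rooted_treeI:
  fixes G :: "'a pair_pre_digraph" and \<mu> :: "'a \<Rightarrow> nat"
  assumes root: "R \<in> pverts G" "\<And>y. (R, y) \<notin> parcs G"
    and parent: "\<And>x. x \<in> pverts G \<Longrightarrow> x \<noteq> R \<Longrightarrow> \<exists>y\<in>pverts G. (x, y) \<in> parcs G \<and> \<mu> y < \<mu> x"
    and unique: "\<And>x y z. (x, y) \<in> parcs G \<Longrightarrow> (x, z) \<in> parcs G \<Longrightarrow> y = z"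
  shows "rooted_tree G R"
  unfolding rooted_tree_def
proof (intro conjI ballI)
  show "R \<in> pverts G" by (fact root)
  interpret pre_digraph "with_proj G" .
  note walk_simps = awalk_def cas.simps
  fix S assume "S \<in> pverts G"
  then have "\<exists>p. awalk S p R"
  proof (induction "\<mu> S" arbitrary: S rule: less_induct)
    case less
    show ?case
    proof (cases "S = R")
      case True
      then have "awalk S [] R" using root by (simp add: walk_simps)
      then show ?thesis by blast
    next
      case False
      then obtain y where y: "y \<in> pverts G" "(S, y) \<in> parcs G" "\<mu> y < \<mu> S"
        using parent less.prems by blast
      then obtain p where "awalk y p R" using less.hyps by blast
      then have "awalk S ((S, y) # p) R" using y less.prems by (simp add: walk_simps)
      then show ?thesis by blast
    qed
  qed
  moreover have "p = q" if "set p \<subseteq> parcs G" "cas S p R" "set q \<subseteq> parcs G" "cas S q R" for p q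
    using that
  proof (induction p arbitrary: S q)
    case Nil
    then show ?case using root(2) by (cases q) auto
  next
    case (Cons e p)
    then obtain y where e: "e = (S, y)" "(S, y) \<in> parcs G" "cas y p R" by (cases e) auto
    then have "S \<noteq> R" using root(2) by blast
    then obtain e' q' where q: "q = e' # q'" using Cons.prems by (cases q) auto
    then obtain z where z: "e' = (S, z)" "(S, z) \<in> parcs G" "cas z q' R"
      using Cons.prems by (cases e') auto
    then have "y = z" using unique e by blast
    moreover have "p = q'" using Cons.IH[of y q'] Cons.prems e z q \<open>y = z\<close> by auto
    ultimately show ?case using e z q by simp
  qed
  ultimately show "\<exists>!p. awalk S p R" by (auto simp: awalk_def)
qed

lemma gns_graph_rooted_tree:
  fixes f :: "nat ^ 'd::finite"
  assumes prec: "monomial_order prec" and "f \<noteq> 0"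
  shows "rooted_tree (gns_graph prec f) (ordinary_gns f)"
proof (rule rooted_treeI[where \<mu> = "\<lambda>T. card (N_set f T)"])
  show "ordinary_gns f \<in> pverts (gns_graph prec f)"
    using ordinary_gns_almost_symmetric[OF \<open>f \<noteq> 0\<close>] by (simp add: gns_graph_def)
  show "\<And>y. (ordinary_gns f, y) \<notin> parcs (gns_graph prec f)"
    by (simp add: gns_graph_def)
  show "\<And>x y z. (x, y) \<in> parcs (gns_graph prec f) \<Longrightarrow> (x, z) \<in> parcs (gns_graph prec f) \<Longrightarrow> y = z"
    by (simp add: gns_graph_def)
next
  fix T assume "T \<in> pverts (gns_graph prec f)" and no: "T \<noteq> ordinary_gns f"
  then have T: "T \<in> almost_symmetric_gns_set f" by (simp add: gns_graph_def)
  let ?S = "T - {low prec f T}"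
  have "finite (N_set f T)" by (rule finite_subset[OF _ finite_box[of f]]) (auto simp: N_set_def)
  moreover have "N_set f ?S \<subset> N_set f T"
    using low_least(1)[OF prec T no] by (auto simp: N_set_def)
  ultimately have "card (N_set f ?S) < card (N_set f T)" by (rule psubset_card_mono)
  moreover have "?S \<in> pverts (gns_graph prec f)"
    using remove_low_almost_symmetric[OF prec T no] by (simp add: gns_graph_def)
  ultimately show "\<exists>S\<in>pverts (gns_graph prec f). (T, S) \<in> parcs (gns_graph prec f)
      \<and> card (N_set f S) < card (N_set f T)"
    using gns_graph_arc_iff[OF prec] T no by blast
qed

text \<open>
  Adding \<open>low T\<close> back gives the almost symmetric \<open>T\<close>, and \<open>low T\<close> precedes \<open>f\<close> because it lies
  below \<open>f\<close> componentwise and \<open>f\<close> is a gap.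
\<close>
lemma low_mem_D_prec:
  fixes T :: "(nat ^ 'd::finite) set"
  assumes prec: "monomial_order prec" and T: "T \<in> almost_symmetric_gns_set f"
    and no: "T \<noteq> ordinary_gns f"
  shows "low prec f T \<in> D_prec prec f (T - {low prec f T})"
proof -
  let ?x = "low prec f T"
  have x: "?x \<in> T" "?x \<noteq> 0" "?x \<le> f" using low_least(1)[OF assms] by (auto simp: N_set_def)
  have "f \<notin> T" using T by (auto simp: almost_symmetric_gns_set_iff gaps_def)
  then have "?x \<noteq> f" using x by auto
  then have "prec ?x f" using monomial_order_extends_le[OF prec x(3)] by blast
  moreover have "insert ?x T = T" using x by auto
  then have "almost_symmetric (T - {?x} \<union> {?x})"
    using T by (simp add: almost_symmetric_gns_set_def)
  moreover have "prec ?x y" if "y \<in> N_set f (T - {?x}) - {0}" for y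
    using low_least(2)[OF assms, of y] that by (auto simp: N_set_def)
  ultimately show ?thesis
    using low_special_gap[OF assms] \<open>?x \<noteq> f\<close> by (auto simp: D_prec_def D_set_def)
qed

text \<open>
  Since \<open>x \<noteq> f\<close>, the gap \<open>f\<close> survives as the greatest one. The element \<open>x\<close> lies in the box and
  precedes all other nonzero elements there, so it is the one that the parent map removes.
\<close>
lemma add_D_prec:
  fixes S :: "(nat ^ 'd::finite) set"
  assumes prec: "monomial_order prec" and S: "S \<in> almost_symmetric_gns_set f"
    and x: "x \<in> D_prec prec f S"
  shows "S \<union> {x} \<in> almost_symmetric_gns_set f" and "S \<union> {x} \<noteq> ordinary_gns f"
    and "low prec f (S \<union> {x}) = x" and "x \<notin> S"
proof -
  have xg: "x \<in> gaps S" "x \<noteq> f" and as: "almost_symmetric (S \<union> {x})"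
    and least: "\<And>y. y \<in> N_set f S - {0} \<Longrightarrow> prec x y"
    using x by (auto simp: D_prec_def D_set_def special_gaps_def pseudo_frobenius_def)
  have S': "0 \<in> S" "finite (gaps S)" "f \<in> gaps S" "\<forall>h\<in>gaps S. h \<le> f"
    using S by (auto simp: almost_symmetric_gns_set_iff gns_def)
  show xS: "x \<notin> S" using xg by (simp add: gaps_def)
  have gaps: "gaps (S \<union> {x}) = gaps S - {x}" by (auto simp: gaps_def)
  have "is_frobenius (S \<union> {x}) f"
    by (subst is_frobenius_iff) (use S' xg in \<open>auto simp: gaps simp del: Un_insert_right\<close>)
  then show T: "S \<union> {x} \<in> almost_symmetric_gns_set f"
    using as by (simp add: almost_symmetric_gns_set_def)
  have xN: "x \<in> N_set f (S \<union> {x}) - {0}" using S' xg xS by (auto simp: N_set_def)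
  then show "S \<union> {x} \<noteq> ordinary_gns f" using ordinary_iff_N_set[OF T] by blast
  show "low prec f (S \<union> {x}) = x"
    by (rule low_eqI[OF prec xN]) (use least in \<open>auto simp: N_set_def\<close>)
qed

theorem theorem4p11:
  fixes prec :: "nat ^ 'd::finite \<Rightarrow> nat ^ 'd \<Rightarrow> bool"
    and f :: "nat ^ 'd"
  assumes "monomial_order prec"
    and "f \<noteq> 0"
  shows "rooted_tree (gns_graph prec f) (ordinary_gns f) \<and>
         (\<forall>S \<in> almost_symmetric_gns_set f.
            children (gns_graph prec f) S = {S \<union> {x} |x. x \<in> D_prec prec f S})"
proof (intro conjI ballI set_eqI iffI)
  show "rooted_tree (gns_graph prec f) (ordinary_gns f)"
    using assms by (rule gns_graph_rooted_tree)
next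
  fix S T
  assume "T \<in> children (gns_graph prec f) S"
  then have T: "T \<in> almost_symmetric_gns_set f" "T \<noteq> ordinary_gns f"
    and S: "S = T - {low prec f T}"
    using gns_graph_arc_iff[OF assms(1)] by (auto simp: children_def)
  have "T = S \<union> {low prec f T}" using low_least(1)[OF assms(1) T] S by (auto simp: N_set_def)
  moreover have "low prec f T \<in> D_prec prec f S" using low_mem_D_prec[OF assms(1) T] S by simp
  ultimately show "T \<in> {S \<union> {x} |x. x \<in> D_prec prec f S}" by blast
next
  fix S T
  assume S: "S \<in> almost_symmetric_gns_set f" and "T \<in> {S \<union> {x} |x. x \<in> D_prec prec f S}"
  then obtain x where x: "x \<in> D_prec prec f S" and T: "T = S \<union> {x}" by blast
  note add = add_D_prec[OF assms(1) S x]
  have "S = T - {x}" using add(4) T by auto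
  then show "T \<in> children (gns_graph prec f) S"
    using add T gns_graph_arc_iff[OF assms(1)] by (simp add: children_def)
qed

end
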